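(* For each positive integer $d$, let $R_d$ be a random correlation matrix drawn from the uniform distribution over the space of $d\times d$ correlation matrices, and let $D_d=\det R_d$. Then, as $d\to\infty$, $D_d^{1/d}$ converges in probability to $\frac1e$.
   Context: The space of $d\times d$ correlation matrices is the set of real symmetric positive definite matrices $R=(\rho_{ij})_{i,j=1,\dots,d}$ with unit diagonal, identified via the entries $(\rho_{ij})_{1\le i<j\le d}$ with a bounded open subset of $\mathbb{R}^{d(d-1)/2}$; the uniform distribution on it is normalized Lebesgue measure on this subset (for $d=1$ the only such matrix is $(1)$). *)

theory Defs
  imports "HOL-Probability.Probability" "Jordan_Normal_Form.Determinant"
begin

definition positive_definite :: "real mat \<Rightarrow> bool" where
  "positive_definite A \<longleftrightarrow>
     (\<forall>v\<in>carrier_vec (dim_row A). v \<noteq> 0\<^sub>v (dim_row A) \<longrightarrow> scalar_prod v (A *\<^sub>v v) > 0)"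

definition correlation_matrices :: "nat \<Rightarrow> real mat set" where
  "correlation_matrices d =
     {R \<in> carrier_mat d d.
        transpose_mat R = R \<and> positive_definite R \<and> (\<forall>i<d. R $$ (i, i) = 1)}"

text \<open>Indices run from 0 to d - 1. The coordinate space is the product of copies of the real line
  over the d(d - 1)/2 pairs (i, j) with i < j; for d = 1 it is a single point of mass 1.\<close>

definition upper_pairs :: "nat \<Rightarrow> (nat \<times> nat) set" where
  "upper_pairs d = {(i, j). i < j \<and> j < d}"

definition upper_entries :: "nat \<Rightarrow> real mat \<Rightarrow> (nat \<times> nat \<Rightarrow> real)" where
  "upper_entries d R = restrict (\<lambda>ij. R $$ ij) (upper_pairs d)"

definition coord_lborel :: "nat \<Rightarrow> (nat \<times> nat \<Rightarrow> real) measure" where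
  "coord_lborel d = Pi\<^sub>M (upper_pairs d) (\<lambda>_. lborel)"

definition uniform_correlation_matrix :: "nat \<Rightarrow> 'a measure \<Rightarrow> ('a \<Rightarrow> real mat) \<Rightarrow> bool" where
  "uniform_correlation_matrix d M R \<longleftrightarrow>
     (\<forall>\<omega>\<in>space M. R \<omega> \<in> correlation_matrices d) \<and>
     (\<lambda>\<omega>. upper_entries d (R \<omega>)) \<in> measurable M (coord_lborel d) \<and>
     distr M (coord_lborel d) (\<lambda>\<omega>. upper_entries d (R \<omega>)) =
       uniform_measure (coord_lborel d) (upper_entries d ` correlation_matrices d)"

text \<open>The limit is a constant, so the random variables may live on different probability spaces.\<close>

definition tendsto_in_probability ::
    "(nat \<Rightarrow> 'a measure) \<Rightarrow> (nat \<Rightarrow> 'a \<Rightarrow> real) \<Rightarrow> real \<Rightarrow> bool" where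
  "tendsto_in_probability M X c \<longleftrightarrow>
     (\<forall>\<epsilon>>0. (\<lambda>n. measure (M n) {\<omega> \<in> space (M n). \<bar>X n \<omega> - c\<bar> > \<epsilon>}) \<longlonglongrightarrow> 0)"

end

theory Submission
  imports Defs "HOL-Real_Asymp.Real_Asymp"
begin

text \<open>
  In terms of its Cholesky factor \<open>L\<close>, a correlation matrix \<open>R = L L\<^sup>T\<close> has
  \<open>det R = (\<Prod>i. 1 - q\<^sub>i)\<close>, where \<open>q\<^sub>i\<close> is the squared length of the strictly lower part of row \<open>i\<close>,
  and the correlation matrices are cut out by the conditions \<open>q\<^sub>i < 1\<close>. Replacing the entries of the
  last column one at a time by the entries of \<open>L\<close> is an affine substitution in each variable, and
  every such step integrates out a factor \<open>\<integral> (1 - t\<^sup>2)\<^sup>s dt = B(1/2, s + 1)\<close> over \<open>-1 < t < 1\<close>.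
  This gives
  \<open>\<integral> (det R)\<^sup>s dR = (\<Prod>p<d-1. B(1/2, s + p/2 + 1)\<^bsup>p+1\<^esup>)\<close> for every real \<open>s > -1\<close>.

  Consecutive ratios (in \<open>d\<close>) of the first moment of the determinant tend to \<open>exp (-1)\<close>; those of the
  moment of order \<open>-1/2\<close> are bounded by a sequence tending to \<open>exp (1/2)\<close>, because the Beta function
  is log-convex. Markov's inequality for these two moments and the ratio test bound both tails.
\<close>

subsection \<open>One-dimensional integrals\<close>

lemma Beta_half_real_pos: "b > 0 \<Longrightarrow> Beta (1/2) b > (0::real)"
  by (simp add: Beta_def)

text \<open>The complex duplication formula restricted to the positive axis: \<open>x > 0\<close>
  keeps both Gamma arguments off the poles. It serves to rewrite \<open>Beta (s + 1) (s + 1)\<close>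
  as a multiple of \<open>Beta (1/2) (s + 1)\<close>.\<close>

lemma Gamma_legendre_duplication_real:
  fixes x :: real
  assumes "x > 0"
  shows "Gamma x * Gamma (x + 1/2) = exp ((1 - 2 * x) * ln 2) * sqrt pi * Gamma (2 * x)"
proof -
  have "x \<notin> \<int>\<^sub>\<le>\<^sub>0" "x + 1/2 \<notin> \<int>\<^sub>\<le>\<^sub>0"
    using assms by (auto elim!: nonpos_Ints_cases)
  then have "complex_of_real x \<notin> \<int>\<^sub>\<le>\<^sub>0" "complex_of_real (x + 1/2) \<notin> \<int>\<^sub>\<le>\<^sub>0"
    unfolding of_real_in_nonpos_Ints_iff by auto
  then have "Gamma (complex_of_real x) * Gamma (complex_of_real (x + 1/2)) =
      complex_of_real (exp ((1 - 2 * x) * ln 2)) * of_real (sqrt pi) * Gamma (complex_of_real (2 * x))"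
    using Gamma_legendre_duplication[of "complex_of_real x"] by (simp add: exp_of_real[symmetric])
  then show ?thesis
    unfolding Gamma_complex_of_real of_real_mult[symmetric] of_real_eq_iff .
qed

text \<open>The substitution x = 2t - 1 turns 1 - x^2 into 4t(1 - t), which gives 2 * 4^s * B(s + 1,
  s + 1); the powers of 2 cancel against those of the duplication formula.\<close>

lemma nn_integral_cap:
  fixes s :: real
  assumes "s > -1"
  shows "(\<integral>\<^sup>+x. indicator {-1<..<1} x * (1 - x\<^sup>2) powr s \<partial>lborel) = ennreal (Beta (1/2) (s + 1))"
proof -
  have "((\<lambda>t. t powr s * (1 - t) powr s) has_integral Beta (s + 1) (s + 1)) {0..1}"
    using has_integral_Beta_real[of "s + 1" "s + 1"] assms by simp
  then have beta: "(\<integral>\<^sup>+t. ennreal (indicator {0..1} t * (t powr s * (1 - t) powr s)) \<partial>lborel) =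
      ennreal (Beta (s + 1) (s + 1))"
    by (subst nn_integral_has_integral_lebesgue[symmetric])
      (auto simp: ennreal_mult' ennreal_indicator mult_ac)
  \<comment> \<open>The open interval on the left matches the closed one on the right because
    \<open>0 powr s = 0\<close> at the endpoints.\<close>
  have eq: "indicator {-1<..<1} (-1 + 2 * t) * (1 - (-1 + 2 * t)\<^sup>2) powr s
      = 4 powr s * (indicator {0..1} t * (t powr s * (1 - t) powr s))" for t :: real
  proof -
    have "1 - (-1 + 2 * t)\<^sup>2 = 4 * (t * (1 - t))"
      by (simp add: power2_eq_square algebra_simps)
    then show ?thesis by (auto simp: indicator_def powr_mult)
  qed
  have "(\<integral>\<^sup>+x. indicator {-1<..<1} x * (1 - x\<^sup>2) powr s \<partial>lborel) =
      ennreal 2 * (\<integral>\<^sup>+t. ennreal (4 powr s) *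
        ennreal (indicator {0..1} t * (t powr s * (1 - t) powr s)) \<partial>lborel)"
    by (subst nn_integral_real_affine[where c = 2 and t = "-1"])
      (simp_all only: eq ennreal_mult'[OF powr_ge_zero], auto)
  also have "\<dots> = ennreal (2 * 4 powr s * Beta (s + 1) (s + 1))"
    by (subst nn_integral_cmult, measurable) (simp only: beta, simp add: ennreal_mult' mult.assoc)
  also have "2 * 4 powr s * Beta (s + 1) (s + 1) = Beta (1/2) (s + 1)"
  proof -
    have pos: "Gamma (2 * (s + 1)) > 0" "Gamma (s + 1 + 1/2) > 0"
      using assms by (auto intro!: Gamma_real_pos)
    have "4 powr s = (2::real) powr (2 * s)"
      by (simp add: powr_powr[symmetric])
    moreover have "exp ((1 - 2 * (s + 1)) * ln 2) = (2::real) powr (-1 - 2 * s)"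
      by (simp add: powr_def)
    ultimately have "2 * 4 powr s * exp ((1 - 2 * (s + 1)) * ln 2) = 1"
      by (simp add: powr_diff powr_minus)
    moreover have "Gamma (s + 1) * Gamma (s + 1 + 1/2) =
        exp ((1 - 2 * (s + 1)) * ln 2) * sqrt pi * Gamma (2 * (s + 1))"
      using assms by (intro Gamma_legendre_duplication_real) simp
    ultimately have "2 * 4 powr s * (Gamma (s + 1) * Gamma (s + 1 + 1/2)) = sqrt pi * Gamma (2 * (s + 1))"
      by simp
    then show ?thesis using pos unfolding Beta_def
      by (simp add: field_simps Gamma_one_half_real)
  qed
  finally show ?thesis .
qed

text \<open>Substituting t = h + c * sqrt (1 - q) * u factors 1 - q - ((t - h) / c)^2 as (1 - q)(1 -
  u^2). The Jacobian contributes c and the square root that raises the exponent of 1 - q by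
  1/2.\<close>

lemma nn_integral_affine_cap:
  fixes s c h q :: real
  assumes "s > -1" "c > 0"
  shows "(\<integral>\<^sup>+t. ennreal (indicator {..<1} (q + ((t - h) / c)\<^sup>2) * (1 - (q + ((t - h) / c)\<^sup>2)) powr s) \<partial>lborel)
    = ennreal (c * Beta (1/2) (s + 1) * (indicator {..<1} q * (1 - q) powr (s + 1/2)))"
proof (cases "q < 1")
  case False
  then have "\<not> q + u\<^sup>2 < 1" for u :: real
    using zero_le_power2[of u] by linarith
  with False show ?thesis by simp
next
  case True
  define a where "a = sqrt (1 - q)"
  have a: "a > 0" "a\<^sup>2 = 1 - q" using True by (auto simp: a_def)
  have eq: "indicator {..<1} (q + (a * u)\<^sup>2) * (1 - (q + (a * u)\<^sup>2)) powr s
     = (1 - q) powr s * (indicator {-1<..<1} u * (1 - u\<^sup>2) powr s)" for u :: real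
  proof -
    have "1 - (q + (a * u)\<^sup>2) = (1 - q) * (1 - u\<^sup>2)"
      by (simp add: power_mult_distrib a algebra_simps)
    moreover have "q + (a * u)\<^sup>2 < 1 \<longleftrightarrow> (1 - q) * (1 - u\<^sup>2) > 0"
      unfolding calculation[symmetric] by auto
    moreover have "\<dots> \<longleftrightarrow> -1 < u \<and> u < 1"
      using True by (auto simp: zero_less_mult_iff abs_square_less_1)
    moreover have "u\<^sup>2 \<le> 1" if "-1 < u" "u < 1"
      using that by (auto simp: abs_square_le_1)
    ultimately show ?thesis
      using True by (auto simp: indicator_def powr_mult)
  qed
  have "(\<integral>\<^sup>+t. ennreal (indicator {..<1} (q + ((t - h) / c)\<^sup>2) * (1 - (q + ((t - h) / c)\<^sup>2)) powr s) \<partial>lborel)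
     = ennreal (c * a) * (\<integral>\<^sup>+u. ennreal (indicator {..<1} (q + (a * u)\<^sup>2) * (1 - (q + (a * u)\<^sup>2)) powr s) \<partial>lborel)"
    using assms a by (subst nn_integral_real_affine[where c = "c * a" and t = h]) auto
  also have "\<dots> = ennreal (c * a) * (ennreal ((1 - q) powr s) * ennreal (Beta (1/2) (s + 1)))"
    unfolding eq nn_integral_cap[OF assms(1), symmetric]
    by (subst nn_integral_cmult[symmetric]) (auto simp: ennreal_mult')
  also have "\<dots> = ennreal (c * Beta (1/2) (s + 1) * ((1 - q) powr (s + 1/2)))"
    using True assms Beta_half_real_pos[of "s + 1"]
    by (simp add: ennreal_mult'[symmetric] a_def powr_add powr_half_sqrt less_imp_le mult_ac
             flip: ennreal_mult)
  finally show ?thesis using True by simp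
qed

subsection \<open>Cholesky coordinates\<close>

text \<open>The recursion only reads the entries \<open>x (j, i)\<close> with \<open>j < i\<close>; the diagonal entries are meant to
  be 1. Outside \<open>chol_region\<close> (defined below) the values involve square roots of negative
  numbers or divisions by 0 and carry no meaning.\<close>

function chol :: "(nat \<times> nat \<Rightarrow> real) \<Rightarrow> nat \<Rightarrow> nat \<Rightarrow> real" where
  "chol x i j =
     (if j < i then (x (j, i) - (\<Sum>k<j. chol x i k * chol x j k)) / chol x j j
      else if j = i then sqrt (1 - (\<Sum>k<i. (chol x i k)\<^sup>2))
      else 0)"
  by auto
termination
  by (relation "measures [\<lambda>(x, i, j). i, \<lambda>(x, i, j). j]") auto

declare chol.simps [simp del]

text \<open>The cutoff \<open>n\<close> is separate from the row \<open>i\<close> because the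
  entries of the last row are integrated out one at a time.\<close>

definition chol_sq :: "(nat \<times> nat \<Rightarrow> real) \<Rightarrow> nat \<Rightarrow> nat \<Rightarrow> real" where
  "chol_sq x i n = (\<Sum>k<n. (chol x i k)\<^sup>2)"

definition chol_region :: "nat \<Rightarrow> (nat \<times> nat \<Rightarrow> real) set" where
  "chol_region d = {x. \<forall>i<d. chol_sq x i i < 1}"

definition chol_det :: "nat \<Rightarrow> (nat \<times> nat \<Rightarrow> real) \<Rightarrow> real" where
  "chol_det d x = (\<Prod>i<d. 1 - chol_sq x i i)"

lemma chol_diag: "chol x i i = sqrt (1 - chol_sq x i i)"
  by (subst chol.simps) (simp add: chol_sq_def)

lemma chol_below: "j < i \<Longrightarrow> chol x i j = (x (j, i) - (\<Sum>k<j. chol x i k * chol x j k)) / chol x j j"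
  by (subst chol.simps) simp

lemma chol_above: "i < j \<Longrightarrow> chol x i j = 0"
  by (subst chol.simps) simp

lemma chol_diag_pos: "x \<in> chol_region d \<Longrightarrow> i < d \<Longrightarrow> chol x i i > 0"
  by (simp add: chol_diag chol_region_def)

lemma chol_det_pos: "x \<in> chol_region d \<Longrightarrow> chol_det d x > 0"
  by (auto simp: chol_det_def chol_region_def intro!: prod_pos)

lemma chol_region_Suc: "x \<in> chol_region (Suc d) \<longleftrightarrow> x \<in> chol_region d \<and> chol_sq x d d < 1"
  by (auto simp: chol_region_def less_Suc_eq)

lemma chol_det_Suc: "chol_det (Suc d) x = chol_det d x * (1 - chol_sq x d d)"
  by (simp add: chol_det_def)

text \<open>Induction along the recursion, which never reads column \<open>i\<close> past row
  \<open>j\<close>. This triangular dependence is what makes the entries exchangeable for those of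
  the factor one by one.\<close>

lemma chol_cong:
  assumes "\<And>a b. a < b \<Longrightarrow> b < i \<Longrightarrow> x (a, b) = y (a, b)"
    and "\<And>a. a \<le> j \<Longrightarrow> a < i \<Longrightarrow> x (a, i) = y (a, i)"
  shows "chol x i j = chol y i j"
  using assms
proof (induction x i j rule: chol.induct)
  case (1 x i j)
  consider "j < i" | "j = i" | "i < j" by linarith
  then show ?case
  proof cases
    case 1
    have "chol x i k = chol y i k" if "k < j" for k
      by (rule "1.IH"(1)) (use that 1 "1.prems" in auto)
    moreover have "chol x j k = chol y j k" if "k < j" for k
      by (rule "1.IH"(2)) (use that 1 "1.prems" in auto)
    moreover have "chol x j j = chol y j j"
      by (rule "1.IH"(3)) (use 1 "1.prems" in auto)
    ultimately show ?thesis
      using "1.prems"(2)[of j] 1 unfolding chol_below[OF 1] by simp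
  next
    case 2
    have "chol x i k = chol y i k" if "k < i" for k
      by (rule "1.IH"(4)) (use that 2 "1.prems" in auto)
    then show ?thesis using 2 by (simp add: chol_diag chol_sq_def)
  next
    case 3
    then show ?thesis by (simp add: chol_above)
  qed
qed

lemma chol_sq_cong:
  assumes "\<And>a b. a < b \<Longrightarrow> b < i \<Longrightarrow> x (a, b) = y (a, b)"
    and "\<And>a. a < n \<Longrightarrow> a < i \<Longrightarrow> x (a, i) = y (a, i)"
  shows "chol_sq x i n = chol_sq y i n"
  unfolding chol_sq_def by (intro sum.cong refl arg_cong[where f = "\<lambda>u. u\<^sup>2"] chol_cong)
    (use assms in auto)

lemma borel_measurable_chol:
  assumes "\<And>a b. a < b \<Longrightarrow> b < i \<Longrightarrow> (a, b) \<in> I"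
    and "\<And>a. a \<le> j \<Longrightarrow> a < i \<Longrightarrow> (a, i) \<in> I"
  shows "(\<lambda>x. chol x i j) \<in> borel_measurable (Pi\<^sub>M I (\<lambda>_. lborel))"
  using assms
\<comment> \<open>The recursive calls leave the argument \<open>x\<close> unchanged, while
  measurability concerns the function of \<open>x\<close>; so a dummy value fills that slot of the
  induction rule.\<close>
proof (induction "undefined :: nat \<times> nat \<Rightarrow> real" i j rule: chol.induct)
  case (1 i j)
  consider "j < i" | "j = i" | "i < j" by linarith
  then show ?case
  proof cases
    case 1
    have m1: "(\<lambda>x. chol x i k) \<in> borel_measurable (Pi\<^sub>M I (\<lambda>_. lborel))" if "k < j" for k
      by (rule "1.hyps"(1)) (use that 1 "1.prems" in auto)
    have m2: "(\<lambda>x. chol x j k) \<in> borel_measurable (Pi\<^sub>M I (\<lambda>_. lborel))" if "k < j" for k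
      by (rule "1.hyps"(2)) (use that 1 "1.prems" in auto)
    have m3: "(\<lambda>x. chol x j j) \<in> borel_measurable (Pi\<^sub>M I (\<lambda>_. lborel))"
      by (rule "1.hyps"(3)) (use 1 "1.prems" in auto)
    have "(\<lambda>x. x (j, i)) \<in> measurable (Pi\<^sub>M I (\<lambda>_. lborel)) lborel"
      by (rule measurable_component_singleton) (use 1 "1.prems" in auto)
    then have m4: "(\<lambda>x. x (j, i)) \<in> borel_measurable (Pi\<^sub>M I (\<lambda>_. lborel))"
      by simp
    show ?thesis
      unfolding chol_below[OF 1]
      by (intro borel_measurable_divide borel_measurable_diff borel_measurable_sum
           borel_measurable_times m1 m2 m3 m4) auto
  next
    case 2
    have "(\<lambda>x. chol x i k) \<in> borel_measurable (Pi\<^sub>M I (\<lambda>_. lborel))" if "k < i" for k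
      by (rule "1.hyps"(4)) (use that 2 "1.prems" in auto)
    then show ?thesis unfolding 2 chol_diag chol_sq_def
      by (intro measurable_compose[OF _ borel_measurable_sqrt] borel_measurable_diff
           borel_measurable_sum borel_measurable_power) auto
  next
    case 3
    then show ?thesis by (simp add: chol_above)
  qed
qed

lemma borel_measurable_chol_sq:
  assumes "\<And>a b. a < b \<Longrightarrow> b < i \<Longrightarrow> (a, b) \<in> I"
    and "\<And>a. a < n \<Longrightarrow> a < i \<Longrightarrow> (a, i) \<in> I"
  shows "(\<lambda>x. chol_sq x i n) \<in> borel_measurable (Pi\<^sub>M I (\<lambda>_. lborel))"
  unfolding chol_sq_def
  by (intro borel_measurable_sum borel_measurable_power borel_measurable_chol)
    (use assms in auto)

section \<open>Gram matrices and positive definiteness\<close>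

lemma sum_chol_truncate:
  assumes "j < n"
  shows "(\<Sum>k<n. a k * chol x j k) = (\<Sum>k<Suc j. a k * chol x j k)"
  by (rule sum.mono_neutral_right) (use assms in \<open>auto simp: chol_above\<close>)

lemma chol_gram_below:
  assumes "j < i" "j < n" "chol x j j \<noteq> 0"
  shows "(\<Sum>k<n. chol x i k * chol x j k) = x (j, i)"
  unfolding sum_chol_truncate[OF assms(2)] using chol_below[OF assms(1), of x] assms(3)
  by (simp add: field_simps)

text \<open>The diagonal entry is chosen to complete row \<open>i\<close> to a unit vector; the
  bound on \<open>chol_sq\<close> makes the square root genuine.\<close>

lemma chol_gram_diag:
  assumes "i < n" "chol_sq x i i < 1"
  shows "(\<Sum>k<n. chol x i k * chol x i k) = 1"
  unfolding sum_chol_truncate[OF assms(1)] using assms(2)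
  by (simp add: chol_diag) (simp add: chol_sq_def power2_eq_square)

text \<open>The system is upper triangular, its matrix being the transpose of \<open>l\<close>. The
  last equation fixes the last unknown as w n / l n n, and its contribution moves to the right-hand
  side of the others.\<close>

lemma back_substitution:
  fixes l :: "nat \<Rightarrow> nat \<Rightarrow> real"
  assumes "\<And>i k. i < k \<Longrightarrow> l i k = 0" "\<And>i. i < n \<Longrightarrow> l i i \<noteq> 0"
  shows "\<exists>y. \<forall>k<n. (\<Sum>i<n. l i k * y i) = w k"
  using assms(2)
proof (induction n arbitrary: w)
  case 0
  then show ?case by simp
next
  case (Suc n)
  obtain y where y: "\<forall>k<n. (\<Sum>i<n. l i k * y i) = w k - l n k * (w n / l n n)"
    using Suc.IH[of "\<lambda>k. w k - l n k * (w n / l n n)"] Suc.prems by auto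
  have "(\<Sum>i<Suc n. l i k * (y(n := w n / l n n)) i) = w k" if "k < Suc n" for k
  proof (cases "k = n")
    case True
    then show ?thesis using assms(1) Suc.prems[of n] by simp
  next
    case False
    then show ?thesis using y that by simp
  qed
  then show ?case by blast
qed

lemma quadratic_form_sum:
  fixes A :: "real mat"
  assumes "A \<in> carrier_mat d d"
  shows "scalar_prod (Matrix.vec d f) (A *\<^sub>v Matrix.vec d f) =
    (\<Sum>i<d. \<Sum>j<d. A $$ (i, j) * f i * f j)"
  using assms unfolding scalar_prod_def
  by (auto simp: scalar_prod_def lessThan_atLeast0 sum_distrib_left mult_ac intro!: sum.cong)

definition chol_mat :: "nat \<Rightarrow> (nat \<times> nat \<Rightarrow> real) \<Rightarrow> real mat" where
  "chol_mat d x = Matrix.mat d d (\<lambda>(i, j). chol x i j)"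

lemma chol_mat_carrier [simp]: "chol_mat d x \<in> carrier_mat d d"
  by (simp add: chol_mat_def)

lemma det_chol_mat: "Determinant.det (chol_mat d x) = (\<Prod>i<d. chol x i i)"
  by (subst det_lower_triangular[of d])
    (auto simp: chol_mat_def chol_above prod_list_diag_prod lessThan_atLeast0)

lemma chol_mat_gram_entry:
  assumes "i < d" "j < d"
  shows "(chol_mat d x * transpose_mat (chol_mat d x)) $$ (i, j) = (\<Sum>k<d. chol x i k * chol x j k)"
  using assms by (simp add: chol_mat_def scalar_prod_def lessThan_atLeast0)

lemma chol_mat_gram:
  assumes "R \<in> carrier_mat d d" "transpose_mat R = R" "\<And>i. i < d \<Longrightarrow> R $$ (i, i) = 1"
    and x: "x \<in> chol_region d" "\<And>i j. i < j \<Longrightarrow> j < d \<Longrightarrow> x (i, j) = R $$ (i, j)"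
  shows "R = chol_mat d x * transpose_mat (chol_mat d x)"
proof (rule eq_matI)
  have sym: "R $$ (i, j) = R $$ (j, i)" if "i < d" "j < d" for i j
    using index_transpose_mat(1)[of i R j] assms(1,2) that by auto
  have below: "(\<Sum>k<d. chol x i k * chol x j k) = R $$ (j, i)" if "j < i" "i < d" for i j
    using that x chol_diag_pos[OF x(1), of j] by (subst chol_gram_below) auto
  have diag: "(\<Sum>k<d. chol x i k * chol x i k) = 1" if "i < d" for i
    using that x by (subst chol_gram_diag) (auto simp: chol_region_def)
  fix i j
  assume "i < dim_row (chol_mat d x * transpose_mat (chol_mat d x))"
    "j < dim_col (chol_mat d x * transpose_mat (chol_mat d x))"
  then have ij: "i < d" "j < d" by (auto simp: chol_mat_def)
  have "(\<Sum>k<d. chol x i k * chol x j k) = R $$ (i, j)"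
  proof (cases i j rule: linorder_cases)
    case less
    then have "(\<Sum>k<d. chol x j k * chol x i k) = R $$ (i, j)" using below ij by blast
    then show ?thesis by (simp add: mult.commute)
  next
    case equal
    then show ?thesis using diag ij assms(3) by simp
  next
    case greater
    then show ?thesis using below sym ij by metis
  qed
  then show "R $$ (i, j) = (chol_mat d x * transpose_mat (chol_mat d x)) $$ (i, j)"
    unfolding chol_mat_gram_entry[OF ij] by simp
qed (use assms in \<open>auto simp: chol_mat_def\<close>)

text \<open>The quadratic form at v is the squared length of L^T v, and L^T is injective since its
  determinant is nonzero.\<close>

lemma positive_definite_gram:
  assumes L: "L \<in> carrier_mat d d" "Determinant.det L \<noteq> 0"
  shows "positive_definite (L * transpose_mat L)"
  unfolding positive_definite_def
proof (intro ballI impI)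
  fix v :: "real Matrix.vec"
  assume "v \<in> carrier_vec (dim_row (L * transpose_mat L))"
    "v \<noteq> 0\<^sub>v (dim_row (L * transpose_mat L))"
  with L have v: "v \<in> carrier_vec d" "v \<noteq> 0\<^sub>v d" by auto
  let ?u = "transpose_mat L *\<^sub>v v"
  have LT: "transpose_mat L \<in> carrier_mat d d" using L by simp
  have u: "?u \<in> carrier_vec d" using L v by auto
  have "?u \<noteq> 0\<^sub>v d"
    using det_0_iff_vec_prod_zero_field[OF LT] det_transpose[OF L(1)] L v by auto
  then have "0 < scalar_prod ?u ?u"
    using conjugate_square_greater_0_vec[OF u] by simp
  also have "\<dots> = scalar_prod v (L *\<^sub>v ?u)"
    using transpose_vec_mult_scalar[OF L(1) u v(1)] .
  also have "L *\<^sub>v ?u = (L * transpose_mat L) *\<^sub>v v"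
    using assoc_mult_mat_vec[OF L(1) LT v(1)] by simp
  finally show "0 < scalar_prod v ((L * transpose_mat L) *\<^sub>v v)" .
qed

text \<open>Strong induction on the row \<open>n\<close>: once the earlier rows are legitimate, a
  test vector is built at which the quadratic form of \<open>R\<close> equals exactly
  \<open>1 - chol_sq x n n\<close>, a Schur complement.\<close>

lemma correlation_matrix_chol_region:
  assumes R: "R \<in> correlation_matrices d"
    and x: "\<And>i j. i < j \<Longrightarrow> j < d \<Longrightarrow> x (i, j) = R $$ (i, j)"
  shows "x \<in> chol_region d"
proof -
  have R': "R \<in> carrier_mat d d" "transpose_mat R = R" "positive_definite R"
    "\<And>i. i < d \<Longrightarrow> R $$ (i, i) = 1"
    using R by (auto simp: correlation_matrices_def)
  have sym: "R $$ (i, j) = R $$ (j, i)" if "i < d" "j < d" for i j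
    using index_transpose_mat(1)[of i R j] R' that by auto
  have "chol_sq x n n < 1" if "n < d" for n
    using that
  proof (induction n rule: less_induct)
    case (less n)
    have sq: "chol_sq x i i < 1" if "i < n" for i using less that by auto
    then have nz: "chol x i i \<noteq> 0" if "i < n" for i using that by (fastforce simp: chol_diag)
    \<comment> \<open>The first \<open>n\<close> entries of row \<open>n\<close> as a linear
      combination of the earlier rows, which are independent since their diagonal entries are
      nonzero.\<close>
    obtain y where y: "\<forall>k<n. (\<Sum>i<n. chol x i k * y i) = chol x n k"
      using back_substitution[of "chol x" n "chol x n"] chol_above nz by blast
    \<comment> \<open>Row \<open>n\<close> minus that combination: \<open>f\<close> annihilates the
      first \<open>n\<close> columns of the factor, as recorded in \<open>f0\<close>.\<close>
    define f where "f i = (if i < n then - y i else if i = n then 1 else 0)" for i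
    have fn: "f n = 1" by (simp add: f_def)
    have "(\<Sum>i<n. chol x i k * f i) = - (\<Sum>i<n. chol x i k * y i)" for k
      unfolding sum_negf[symmetric] by (intro sum.cong) (auto simp: f_def)
    then have f0: "(\<Sum>i<Suc n. chol x i k * f i) = 0" if "k < n" for k
      using y that by (simp add: fn)
    define G where "G i j = (\<Sum>k<n. chol x i k * chol x j k)" for i j
    have G_sym: "G i j = G j i" for i j by (simp add: G_def mult.commute)
    have below: "R $$ (j, i) = G i j" if "j < i" "i \<le> n" for i j
      using that less.prems nz x by (simp add: G_def chol_gram_below)
    \<comment> \<open>Cutting the rows off after \<open>n\<close> entries loses only the square of
      the diagonal entry of row \<open>n\<close>, so the leading block of \<open>R\<close> differs
      from \<open>G\<close> in the corner alone. The positivity of that corner term is not yet known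
      here.\<close>
    have RG: "R $$ (i, j) = G i j + (if i = n then if j = n then 1 - chol_sq x n n else 0 else 0)"
      if "i < Suc n" "j < Suc n" for i j
    proof (cases i j rule: linorder_cases)
      case less
      then show ?thesis using below[of i j] that G_sym by auto
    next
      case equal
      then show ?thesis using that R'(4)[of i] less.prems chol_gram_diag[of i n x] sq
        by (auto simp: G_def chol_sq_def power2_eq_square)
    next
      case greater
      then show ?thesis using below[of j i] that sym[of i j] less.prems by auto
    qed
    have "Matrix.vec d f \<noteq> 0\<^sub>v d"
    proof
      assume "Matrix.vec d f = 0\<^sub>v d"
      then have "vec_index (Matrix.vec d f) n = vec_index (0\<^sub>v d) n" by simp
      then show False using less.prems fn by simp
    qed
    then have "0 < scalar_prod (Matrix.vec d f) (R *\<^sub>v Matrix.vec d f)"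
      using R' by (auto simp: positive_definite_def)
    also have "\<dots> = (\<Sum>i<d. \<Sum>j<d. R $$ (i, j) * f i * f j)"
      by (rule quadratic_form_sum[OF R'(1)])
    also have "\<dots> = (\<Sum>i<Suc n. \<Sum>j<d. R $$ (i, j) * f i * f j)"
      by (rule sum.mono_neutral_right) (use less.prems in \<open>auto simp: f_def\<close>)
    also have "\<dots> = (\<Sum>i<Suc n. \<Sum>j<Suc n. R $$ (i, j) * f i * f j)"
      by (intro sum.cong refl sum.mono_neutral_right) (use less.prems in \<open>auto simp: f_def\<close>)
    also have "\<dots> = (\<Sum>i<Suc n. \<Sum>j<Suc n. G i j * f i * f j +
        (if i = n then if j = n then 1 - chol_sq x n n else 0 else 0))"
      by (intro sum.cong refl, subst RG) (auto simp: fn algebra_simps)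
    also have "\<dots> = (\<Sum>i<Suc n. \<Sum>j<Suc n. G i j * f i * f j) + (1 - chol_sq x n n)"
      by (simp add: sum.distrib sum.If_cases if_distrib)
    \<comment> \<open>The form of a Gram matrix is a sum of squares over the columns
      \<open>k\<close>, and each square vanishes by \<open>f0\<close>.\<close>
    also have "(\<Sum>i<Suc n. \<Sum>j<Suc n. G i j * f i * f j) =
        (\<Sum>i<Suc n. \<Sum>j<Suc n. \<Sum>k<n. (chol x i k * f i) * (chol x j k * f j))"
      unfolding G_def sum_distrib_right by (simp only: mult_ac)
    also have "\<dots> = (\<Sum>i<Suc n. \<Sum>k<n. \<Sum>j<Suc n. (chol x i k * f i) * (chol x j k * f j))"
      by (intro sum.cong refl sum.swap)
    also have "\<dots> = (\<Sum>k<n. \<Sum>i<Suc n. \<Sum>j<Suc n. (chol x i k * f i) * (chol x j k * f j))"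
      by (rule sum.swap)
    also have "\<dots> = (\<Sum>k<n. (\<Sum>i<Suc n. chol x i k * f i) * (\<Sum>j<Suc n. chol x j k * f j))"
      by (simp only: sum_product)
    also have "\<dots> = 0"
      by (intro sum.neutral ballI) (simp only: f0 lessThan_iff mult_zero_left)
    finally show ?case by simp
  qed
  then show ?thesis by (simp add: chol_region_def)
qed

text \<open>One inclusion is the test-vector argument; for the other, the symmetric completion with
  unit diagonal is the Gram matrix of an invertible factor. Intersecting with the space selects the
  functions that are \<open>undefined\<close> off \<open>upper_pairs d\<close>.\<close>

lemma upper_entries_correlation_matrices:
  "upper_entries d ` correlation_matrices d =
     chol_region d \<inter> space (coord_lborel d)"
proof (intro equalityI subsetI)
  fix x assume "x \<in> upper_entries d ` correlation_matrices d"
  then obtain R where R: "R \<in> correlation_matrices d" "x = upper_entries d R" by auto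
  then have "x \<in> chol_region d"
    by (intro correlation_matrix_chol_region[OF R(1)]) (auto simp: upper_entries_def upper_pairs_def)
  then show "x \<in> chol_region d \<inter> space (coord_lborel d)"
    using R by (auto simp: upper_entries_def coord_lborel_def space_PiM)
next
  fix x assume x: "x \<in> chol_region d \<inter> space (coord_lborel d)"
  define R where "R = Matrix.mat d d (\<lambda>(i, j). if i < j then x (i, j) else if j < i then x (j, i) else 1)"
  have R: "R \<in> carrier_mat d d" "transpose_mat R = R" "\<And>i. i < d \<Longrightarrow> R $$ (i, i) = 1"
    "\<And>i j. i < j \<Longrightarrow> j < d \<Longrightarrow> x (i, j) = R $$ (i, j)"
    by (auto simp: R_def intro!: eq_matI)
  have "Determinant.det (chol_mat d x) \<noteq> 0"
    using x chol_diag_pos[of x d] by (fastforce simp: det_chol_mat)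
  then have "positive_definite R"
    using chol_mat_gram[OF R(1-3) _ R(4)] x positive_definite_gram[OF chol_mat_carrier] by auto
  then have "R \<in> correlation_matrices d" using R by (auto simp: correlation_matrices_def)
  moreover have "x = upper_entries d R"
    using x R(4) by (auto simp: upper_entries_def upper_pairs_def coord_lborel_def space_PiM
        restrict_def PiE_def extensional_def fun_eq_iff)
  ultimately show "x \<in> upper_entries d ` correlation_matrices d" by blast
qed

text \<open>The determinant is the squared determinant of the triangular factor, and its squared
  diagonal entries are \<open>1 - chol_sq x i i\<close>.\<close>

lemma det_correlation_matrix:
  assumes "R \<in> correlation_matrices d"
  shows "Determinant.det R = chol_det d (upper_entries d R)"
proof -
  let ?x = "upper_entries d R"
  have x: "?x (i, j) = R $$ (i, j)" if "i < j" "j < d" for i j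
    using that by (simp add: upper_entries_def upper_pairs_def)
  have reg: "?x \<in> chol_region d"
    by (rule correlation_matrix_chol_region[OF assms x])
  have "R = chol_mat d ?x * transpose_mat (chol_mat d ?x)"
    using assms reg x by (intro chol_mat_gram) (auto simp: correlation_matrices_def)
  then have "Determinant.det R = Determinant.det (chol_mat d ?x) * Determinant.det (transpose_mat (chol_mat d ?x))"
    by (metis chol_mat_carrier det_mult transpose_carrier_mat)
  also have "\<dots> = (\<Prod>i<d. chol ?x i i * chol ?x i i)"
    by (simp add: det_transpose[of _ d] det_chol_mat prod.distrib)
  also have "\<dots> = chol_det d ?x"
    unfolding chol_det_def using reg
    by (intro prod.cong) (auto simp: chol_diag chol_region_def)
  finally show ?thesis .
qed

subsection \<open>Moments of the determinant\<close>

text \<open>Interpolates between the coordinates for dimension \<open>d\<close> and those for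
  \<open>Suc d\<close>, adding the new column from the top.\<close>

definition partial_pairs :: "nat \<Rightarrow> nat \<Rightarrow> (nat \<times> nat) set" where
  "partial_pairs d n = upper_pairs d \<union> (\<lambda>k. (k, d)) ` {..<n}"

lemma finite_upper_pairs: "finite (upper_pairs d)"
  by (rule finite_subset[of _ "{..<d} \<times> {..<d}"]) (auto simp: upper_pairs_def)

lemma finite_partial_pairs: "finite (partial_pairs d n)"
  by (simp add: partial_pairs_def finite_upper_pairs)

lemma partial_pairs_0: "partial_pairs d 0 = upper_pairs d"
  by (simp add: partial_pairs_def)

lemma partial_pairs_Suc: "partial_pairs d (Suc n) = insert (n, d) (partial_pairs d n)"
  by (auto simp: partial_pairs_def lessThan_Suc)

lemma partial_pairs_full: "partial_pairs d d = upper_pairs (Suc d)"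
  by (auto simp: partial_pairs_def upper_pairs_def less_Suc_eq)

lemma not_in_partial_pairs: "(n, d) \<notin> partial_pairs d n"
  by (auto simp: partial_pairs_def upper_pairs_def)

text \<open>By Fubini the coordinate \<open>(n, d)\<close> is integrated first. The factor's entry
  is affine in it with slope \<open>1 / chol x n n\<close>, so the affine cap integral applies.
  Confining the support of \<open>g\<close> to the region makes this slope positive wherever it
  matters.\<close>

lemma nn_integral_add_coordinate:
  fixes g :: "(nat \<times> nat \<Rightarrow> real) \<Rightarrow> ennreal"
  assumes "s > -1" "n < d"
    and g [measurable]: "g \<in> borel_measurable (Pi\<^sub>M (partial_pairs d (Suc n)) (\<lambda>_. lborel))"
    and g': "\<And>x t. g (x((n, d) := t)) = g x"
    and region: "\<And>x. g x \<noteq> 0 \<Longrightarrow> x \<in> chol_region d"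
  shows "(\<integral>\<^sup>+x. g x * ennreal (indicator {..<1} (chol_sq x d (Suc n)) * (1 - chol_sq x d (Suc n)) powr s)
            \<partial>Pi\<^sub>M (partial_pairs d (Suc n)) (\<lambda>_. lborel))
    = ennreal (Beta (1/2) (s + 1)) *
      (\<integral>\<^sup>+x. (g x * ennreal (chol x n n)) *
            ennreal (indicator {..<1} (chol_sq x d n) * (1 - chol_sq x d n) powr (s + 1/2))
            \<partial>Pi\<^sub>M (partial_pairs d n) (\<lambda>_. lborel))"
proof -
  interpret product_sigma_finite "\<lambda>_::nat \<times> nat. lborel :: real measure"
    by standard
  let ?F = "\<lambda>x. g x * ennreal (indicator {..<1} (chol_sq x d (Suc n)) * (1 - chol_sq x d (Suc n)) powr s)"
  let ?G = "\<lambda>x. (g x * ennreal (chol x n n)) *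
            ennreal (indicator {..<1} (chol_sq x d n) * (1 - chol_sq x d n) powr (s + 1/2))"
  let ?B = "ennreal (Beta (1/2) (s + 1))"
  have [measurable]: "(\<lambda>x. chol_sq x d (Suc n)) \<in> borel_measurable (Pi\<^sub>M (partial_pairs d (Suc n)) (\<lambda>_. lborel))"
    by (rule borel_measurable_chol_sq) (auto simp: partial_pairs_def upper_pairs_def)
  have [measurable]: "(\<lambda>x. chol_sq x d n) \<in> borel_measurable (Pi\<^sub>M (partial_pairs d n) (\<lambda>_. lborel))"
    by (rule borel_measurable_chol_sq) (auto simp: partial_pairs_def upper_pairs_def)
  have [measurable]: "(\<lambda>x. chol x n n) \<in> borel_measurable (Pi\<^sub>M (partial_pairs d n) (\<lambda>_. lborel))"
    by (rule borel_measurable_chol) (use assms(2) in \<open>auto simp: partial_pairs_def upper_pairs_def\<close>)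
  \<comment> \<open>As \<open>g\<close> ignores the coordinate \<open>(n, d)\<close>, filling it
    with 0 carries measurability over to the smaller product.\<close>
  have "(\<lambda>x. g (x((n, d) := 0))) \<in> borel_measurable (Pi\<^sub>M (partial_pairs d n) (\<lambda>_. lborel))"
    by (rule measurable_compose[OF _ g], unfold partial_pairs_Suc, rule measurable_fun_upd[where J = "partial_pairs d n"]) auto
  then have [measurable]: "g \<in> borel_measurable (Pi\<^sub>M (partial_pairs d n) (\<lambda>_. lborel))"
    by (simp add: g')
  have F [measurable]: "?F \<in> borel_measurable (Pi\<^sub>M (partial_pairs d (Suc n)) (\<lambda>_. lborel))"
    by measurable
  have inner: "(\<integral>\<^sup>+t. ?F (x((n, d) := t)) \<partial>lborel) = ?B * ?G x" for x
  proof (cases "g x = 0")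
    case True
    then show ?thesis by (simp add: g')
  next
    case False
    then have x: "x \<in> chol_region d" by (rule region)
    define h where "h = (\<Sum>k<n. chol x d k * chol x n k)"
    have c: "chol x n n > 0" using x assms(2) by (rule chol_diag_pos)
    have old: "chol (x((n, d) := t)) i k = chol x i k" if "i < d \<or> i = d \<and> k < n" for t i k
      by (rule chol_cong) (use that in auto)
    have "chol_sq (x((n, d) := t)) d (Suc n) = chol_sq x d n + ((t - h) / chol x n n)\<^sup>2" for t
    proof -
      have "chol (x((n, d) := t)) d n = (t - h) / chol x n n"
        unfolding chol_below[OF assms(2)] using assms(2) by (simp add: old h_def)
      then show ?thesis by (simp add: chol_sq_def old)
    qed
    then have "(\<integral>\<^sup>+t. ?F (x((n, d) := t)) \<partial>lborel) =
      g x * (\<integral>\<^sup>+t. ennreal (indicator {..<1} (chol_sq x d n + ((t - h) / chol x n n)\<^sup>2) *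
         (1 - (chol_sq x d n + ((t - h) / chol x n n)\<^sup>2)) powr s) \<partial>lborel)"
      by (simp add: g' nn_integral_cmult)
    also have "\<dots> = g x * ennreal (chol x n n * Beta (1/2) (s + 1) *
         (indicator {..<1} (chol_sq x d n) * (1 - chol_sq x d n) powr (s + 1/2)))"
      by (subst nn_integral_affine_cap) (use assms c in auto)
    also have "\<dots> = ?B * ?G x"
      using c Beta_half_real_pos[of "s + 1"] assms(1)
      by (simp add: ennreal_mult less_imp_le mult_ac)
    finally show ?thesis .
  qed
  have "(\<integral>\<^sup>+x. ?F x \<partial>Pi\<^sub>M (partial_pairs d (Suc n)) (\<lambda>_. lborel)) =
     (\<integral>\<^sup>+x. (\<integral>\<^sup>+t. ?F (x((n, d) := t)) \<partial>lborel) \<partial>Pi\<^sub>M (partial_pairs d n) (\<lambda>_. lborel))"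
    using F unfolding partial_pairs_Suc
    by (intro product_nn_integral_insert finite_partial_pairs not_in_partial_pairs)
  also have "\<dots> = (\<integral>\<^sup>+x. ?B * ?G x \<partial>Pi\<^sub>M (partial_pairs d n) (\<lambda>_. lborel))"
    by (simp only: inner)
  also have "\<dots> = ?B * (\<integral>\<^sup>+x. ?G x \<partial>Pi\<^sub>M (partial_pairs d n) (\<lambda>_. lborel))"
    by (rule nn_integral_cmult) measurable
  finally show ?thesis .
qed

text \<open>Each step moves a factor \<open>chol x n n\<close> into the weight and raises the
  exponent by 1/2, so the induction generalizes over both \<open>g\<close> and
  \<open>s\<close>.\<close>

lemma nn_integral_add_coordinates:
  fixes g :: "(nat \<times> nat \<Rightarrow> real) \<Rightarrow> ennreal"
  assumes "s > -1" "n \<le> d"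
    and "\<And>m. m \<le> n \<Longrightarrow> g \<in> borel_measurable (Pi\<^sub>M (partial_pairs d m) (\<lambda>_. lborel))"
    and "\<And>x k t. g (x((k, d) := t)) = g x"
    and "\<And>x. g x \<noteq> 0 \<Longrightarrow> x \<in> chol_region d"
  shows "(\<integral>\<^sup>+x. g x * ennreal (indicator {..<1} (chol_sq x d n) * (1 - chol_sq x d n) powr s)
            \<partial>Pi\<^sub>M (partial_pairs d n) (\<lambda>_. lborel))
    = ennreal (\<Prod>m<n. Beta (1/2) (s + real m / 2 + 1)) *
      (\<integral>\<^sup>+x. g x * ennreal (\<Prod>j<n. chol x j j) \<partial>Pi\<^sub>M (upper_pairs d) (\<lambda>_. lborel))"
  using assms
proof (induction n arbitrary: g s)
  case 0
  then show ?case by (simp add: chol_sq_def partial_pairs_0)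
next
  case (Suc n)
  have pos: "chol x j j > 0" if "g x \<noteq> 0" "j < d" for x j
    using chol_diag_pos Suc.prems(5) that by blast
  \<comment> \<open>Row \<open>n\<close> lies above row \<open>d\<close> and never reads column
    \<open>d\<close>, so the enlarged weight is still independent of the new column.\<close>
  have inv: "chol (x((k, d) := t)) n n = chol x n n" for x k t
    by (rule chol_cong) (use Suc.prems(2) in auto)
  have "(\<integral>\<^sup>+x. g x * ennreal (indicator {..<1} (chol_sq x d (Suc n)) * (1 - chol_sq x d (Suc n)) powr s)
            \<partial>Pi\<^sub>M (partial_pairs d (Suc n)) (\<lambda>_. lborel))
     = ennreal (Beta (1/2) (s + 1)) *
      (\<integral>\<^sup>+x. (g x * ennreal (chol x n n)) *
            ennreal (indicator {..<1} (chol_sq x d n) * (1 - chol_sq x d n) powr (s + 1/2))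
            \<partial>Pi\<^sub>M (partial_pairs d n) (\<lambda>_. lborel))"
    by (rule nn_integral_add_coordinate[OF _ _ Suc.prems(3) Suc.prems(4,5)]) (use Suc.prems(1,2) in auto)
  also have "(\<integral>\<^sup>+x. (g x * ennreal (chol x n n)) *
            ennreal (indicator {..<1} (chol_sq x d n) * (1 - chol_sq x d n) powr (s + 1/2))
            \<partial>Pi\<^sub>M (partial_pairs d n) (\<lambda>_. lborel)) =
      ennreal (\<Prod>m<n. Beta (1/2) (s + 1/2 + real m / 2 + 1)) *
      (\<integral>\<^sup>+x. (g x * ennreal (chol x n n)) * ennreal (\<Prod>j<n. chol x j j) \<partial>Pi\<^sub>M (upper_pairs d) (\<lambda>_. lborel))"
  proof (rule Suc.IH)
    fix m assume "m \<le> n"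
    then have [measurable]: "g \<in> borel_measurable (Pi\<^sub>M (partial_pairs d m) (\<lambda>_. lborel))"
      by (intro Suc.prems(3)) simp
    have [measurable]: "(\<lambda>x. chol x n n) \<in> borel_measurable (Pi\<^sub>M (partial_pairs d m) (\<lambda>_. lborel))"
      by (rule borel_measurable_chol)
        (use Suc.prems(2) in \<open>auto simp: partial_pairs_def upper_pairs_def\<close>)
    show "(\<lambda>x. g x * ennreal (chol x n n)) \<in> borel_measurable (Pi\<^sub>M (partial_pairs d m) (\<lambda>_. lborel))"
      by measurable
  next
    fix x assume "g x * ennreal (chol x n n) \<noteq> 0"
    then show "x \<in> chol_region d" using Suc.prems(5)[of x] by auto
  next
    show "g (x((k, d) := t)) * ennreal (chol (x((k, d) := t)) n n) = g x * ennreal (chol x n n)"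
      for x k t unfolding inv Suc.prems(4) ..
  qed (use Suc.prems in auto)
  also have "(\<integral>\<^sup>+x. (g x * ennreal (chol x n n)) * ennreal (\<Prod>j<n. chol x j j) \<partial>Pi\<^sub>M (upper_pairs d) (\<lambda>_. lborel))
     = (\<integral>\<^sup>+x. g x * ennreal (\<Prod>j<Suc n. chol x j j) \<partial>Pi\<^sub>M (upper_pairs d) (\<lambda>_. lborel))"
  proof (rule nn_integral_cong)
    fix x
    show "(g x * ennreal (chol x n n)) * ennreal (\<Prod>j<n. chol x j j) =
      g x * ennreal (\<Prod>j<Suc n. chol x j j)"
      using pos[of x n] Suc.prems(2)
      by (cases "g x = 0") (auto simp: ennreal_mult' mult_ac)
  qed
  \<comment> \<open>Raising \<open>s\<close> by 1/2 shifts the index \<open>m\<close> by one, and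
    the new factor fills the slot m = 0.\<close>
  also have "ennreal (Beta (1/2) (s + 1)) * (ennreal (\<Prod>m<n. Beta (1/2) (s + 1/2 + real m / 2 + 1)) * X)
     = ennreal (\<Prod>m<Suc n. Beta (1/2) (s + real m / 2 + 1)) * X" for X
  proof -
    have "Beta (1/2) (s + 1) \<ge> 0" using Beta_half_real_pos[of "s + 1"] Suc.prems(1) by simp
    then show ?thesis unfolding prod.lessThan_Suc_shift
      by (simp add: ennreal_mult' mult.assoc add_divide_distrib add_ac)
  qed
  finally show ?case .
qed

section \<open>Recursion over the dimension\<close>

lemma chol_region_measurable:
  assumes "upper_pairs d \<subseteq> I"
  shows "chol_region d \<inter> space (Pi\<^sub>M I (\<lambda>_. lborel)) \<in> sets (Pi\<^sub>M I (\<lambda>_. lborel))"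
proof -
  have [measurable]: "(\<lambda>x. chol_sq x i i) \<in> borel_measurable (Pi\<^sub>M I (\<lambda>_. lborel))" if "i < d" for i
    by (rule borel_measurable_chol_sq) (use that assms in \<open>auto simp: upper_pairs_def\<close>)
  have "chol_region d \<inter> space (Pi\<^sub>M I (\<lambda>_. lborel)) =
    {x \<in> space (Pi\<^sub>M I (\<lambda>_. lborel)). \<forall>i\<in>{..<d}. chol_sq x i i < 1}"
    by (auto simp: chol_region_def)
  also have "\<dots> \<in> sets (Pi\<^sub>M I (\<lambda>_. lborel))"
    by (rule sets.sets_Collect_finite_All) auto
  finally show ?thesis .
qed

lemma borel_measurable_chol_det:
  assumes "upper_pairs d \<subseteq> I"
  shows "chol_det d \<in> borel_measurable (Pi\<^sub>M I (\<lambda>_. lborel))"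
proof -
  have "(\<lambda>x. chol_sq x i i) \<in> borel_measurable (Pi\<^sub>M I (\<lambda>_. lborel))" if "i < d" for i
    by (rule borel_measurable_chol_sq) (use that assms in \<open>auto simp: upper_pairs_def\<close>)
  then show ?thesis unfolding chol_det_def[abs_def]
    by (intro borel_measurable_prod borel_measurable_diff) auto
qed

lemma prod_chol_diag: "(\<Prod>j<d. chol x j j) = sqrt (chol_det d x)"
  by (induction d) (simp_all add: chol_diag chol_det_def real_sqrt_mult)

text \<open>The moment before normalization; at s = 0 it is the volume of the set of correlation
  matrices.\<close>

definition det_moment :: "nat \<Rightarrow> real \<Rightarrow> ennreal" where
  "det_moment d s =
     (\<integral>\<^sup>+x. indicator (chol_region d) x * ennreal (chol_det d x powr s) \<partial>coord_lborel d)"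

lemma det_moment_0: "det_moment 0 s = 1"
  by (simp add: det_moment_def coord_lborel_def upper_pairs_def PiM_empty chol_region_def
      chol_det_def nn_integral_count_space_finite)

text \<open>Integrating out the whole new column leaves the product of the diagonal entries of the
  old factor, the square root of the old determinant; hence the exponent
  \<open>s + 1/2\<close>.\<close>

lemma det_moment_Suc:
  assumes "s > -1"
  shows "det_moment (Suc d) s =
    ennreal (\<Prod>m<d. Beta (1/2) (s + real m / 2 + 1)) * det_moment d (s + 1/2)"
proof -
  let ?g = "\<lambda>x. indicator (chol_region d) x * ennreal (chol_det d x powr s)"
  have inv: "chol_sq (x((k, d) := t)) i i = chol_sq x i i" if "i < d" for x k t i
    by (rule chol_sq_cong) (use that in auto)
  have g_meas: "?g \<in> borel_measurable (Pi\<^sub>M (partial_pairs d m) (\<lambda>_. lborel))" for m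
  proof -
    have sub: "upper_pairs d \<subseteq> partial_pairs d m" by (simp add: partial_pairs_def)
    note [measurable] = borel_measurable_chol_det[OF sub]
    have [measurable]: "(indicator (chol_region d) :: _ \<Rightarrow> ennreal) \<in>
        borel_measurable (Pi\<^sub>M (partial_pairs d m) (\<lambda>_. lborel))"
      by (simp add: borel_measurable_indicator_iff chol_region_measurable[OF sub])
    show ?thesis by measurable
  qed
  have "det_moment (Suc d) s =
    (\<integral>\<^sup>+x. ?g x * ennreal (indicator {..<1} (chol_sq x d d) * (1 - chol_sq x d d) powr s)
            \<partial>Pi\<^sub>M (partial_pairs d d) (\<lambda>_. lborel))"
    unfolding det_moment_def coord_lborel_def partial_pairs_full
    by (intro nn_integral_cong)
      (auto simp: indicator_def chol_region_Suc chol_det_Suc powr_mult ennreal_mult' chol_det_pos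
        less_imp_le)
  also have "\<dots> = ennreal (\<Prod>m<d. Beta (1/2) (s + real m / 2 + 1)) *
      (\<integral>\<^sup>+x. ?g x * ennreal (\<Prod>j<d. chol x j j) \<partial>Pi\<^sub>M (upper_pairs d) (\<lambda>_. lborel))"
  proof (rule nn_integral_add_coordinates)
    show "?g (x((k, d) := t)) = ?g x" for x k t
      using inv by (simp add: indicator_def chol_region_def chol_det_def)
    show "x \<in> chol_region d" if "?g x \<noteq> 0" for x
      using that by (auto simp: indicator_def split: if_splits)
  qed (use assms g_meas in auto)
  also have "(\<integral>\<^sup>+x. ?g x * ennreal (\<Prod>j<d. chol x j j) \<partial>Pi\<^sub>M (upper_pairs d) (\<lambda>_. lborel)) =
    det_moment d (s + 1/2)"
    unfolding det_moment_def coord_lborel_def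
  proof (rule nn_integral_cong)
    fix x
    show "?g x * ennreal (\<Prod>j<d. chol x j j) =
      indicator (chol_region d) x * ennreal (chol_det d x powr (s + 1/2))"
    proof (cases "x \<in> chol_region d")
      case True
      have "(\<Prod>j<d. chol x j j) = sqrt (chol_det d x)"
        by (rule prod_chol_diag)
      also have "\<dots> = chol_det d x powr (1/2)"
        using chol_det_pos[OF True] by (simp add: powr_half_sqrt)
      finally show ?thesis by (simp add: ennreal_mult'[symmetric] powr_add mult.assoc)
    qed simp
  qed
  finally show ?thesis .
qed

text \<open>Unrolling the recursion, the Beta value with index \<open>p\<close> arises once from
  each of p + 1 combinations of half-steps and column entries.\<close>

lemma det_moment_closed_form:
  assumes "s > -1"
  shows "det_moment (Suc d) s = ennreal (\<Prod>p<d. Beta (1/2) (s + real p / 2 + 1) ^ Suc p)"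
  using assms
proof (induction d arbitrary: s)
  case 0
  then show ?case by (simp add: det_moment_Suc det_moment_0)
next
  case (Suc d)
  let ?b = "\<lambda>p. Beta (1/2) (s + real p / 2 + 1)"
  have pos: "?b p > 0" for p by (rule Beta_half_real_pos) (use Suc.prems in auto)
  have "det_moment (Suc (Suc d)) s = ennreal (\<Prod>m<Suc d. ?b m) *
      ennreal (\<Prod>p<d. Beta (1/2) (s + 1/2 + real p / 2 + 1) ^ Suc p)"
    by (subst det_moment_Suc, use Suc.prems in simp, subst Suc.IH) (use Suc.prems in auto)
  also have "(\<Prod>p<d. Beta (1/2) (s + 1/2 + real p / 2 + 1) ^ Suc p) = (\<Prod>p<d. ?b (Suc p) ^ Suc p)"
    by (intro prod.cong refl) (simp add: add_divide_distrib add_ac)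
  \<comment> \<open>The extra term at p = 0 has exponent 0 and equals 1.\<close>
  also have "\<dots> = (\<Prod>p<Suc d. ?b p ^ p)"
    unfolding prod.lessThan_Suc_shift by simp
  also have "ennreal (\<Prod>m<Suc d. ?b m) * ennreal (\<Prod>p<Suc d. ?b p ^ p) =
     ennreal (\<Prod>p<Suc d. ?b p ^ Suc p)"
    using prod_nonneg[of "{..<Suc d}" ?b] pos
    by (subst ennreal_mult'[symmetric]) (simp_all only: prod.distrib power_Suc less_imp_le)
  finally show ?case .
qed

section \<open>Normalized moments and tail bounds\<close>

text \<open>The expected \<open>s\<close>-th power of the determinant in dimension
  \<open>Suc d\<close>, not \<open>d\<close>.\<close>

definition det_moment_ratio :: "nat \<Rightarrow> real \<Rightarrow> real" where
  "det_moment_ratio d s =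
     (\<Prod>p<d. (Beta (1/2) (s + real p / 2 + 1) / Beta (1/2) (real p / 2 + 1)) ^ Suc p)"

lemma det_moment_ratio_nonneg:
  assumes "s > -1"
  shows "det_moment_ratio d s \<ge> 0"
  unfolding det_moment_ratio_def using assms
  by (intro prod_nonneg zero_le_power divide_nonneg_nonneg less_imp_le[OF Beta_half_real_pos]) auto

text \<open>The integral is pushed forward to the coordinate space, where the uniform law is
  Lebesgue measure on the region divided by its volume, the zeroth moment.\<close>

lemma nn_integral_det_powr:
  assumes "uniform_correlation_matrix (Suc d) M R" "s > -1"
  shows "(\<lambda>\<omega>. Determinant.det (R \<omega>)) \<in> borel_measurable M"
    and "(\<integral>\<^sup>+\<omega>. ennreal (Determinant.det (R \<omega>) powr s) \<partial>M) = ennreal (det_moment_ratio d s)"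
proof -
  let ?C = "coord_lborel (Suc d)" and ?X = "\<lambda>\<omega>. upper_entries (Suc d) (R \<omega>)"
  let ?A = "chol_region (Suc d) \<inter> space ?C"
  have X [measurable]: "?X \<in> measurable M ?C"
    and distr: "distr M ?C ?X = uniform_measure ?C ?A"
    and R: "\<And>\<omega>. \<omega> \<in> space M \<Longrightarrow> R \<omega> \<in> correlation_matrices (Suc d)"
    using assms(1) by (auto simp: uniform_correlation_matrix_def upper_entries_correlation_matrices)
  have det [measurable]: "chol_det (Suc d) \<in> borel_measurable ?C"
    unfolding coord_lborel_def by (rule borel_measurable_chol_det) simp
  have A [measurable]: "?A \<in> sets ?C"
    unfolding coord_lborel_def by (rule chol_region_measurable) simp
  have eq: "Determinant.det (R \<omega>) = chol_det (Suc d) (?X \<omega>)" if "\<omega> \<in> space M" for \<omega>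
    using R[OF that] by (rule det_correlation_matrix)
  show "(\<lambda>\<omega>. Determinant.det (R \<omega>)) \<in> borel_measurable M"
    by (subst measurable_cong[OF eq]) measurable
  have "emeasure ?C ?A = det_moment (Suc d) 0"
    unfolding det_moment_def
    by (subst nn_integral_indicator[symmetric, OF A], intro nn_integral_cong)
      (auto simp: indicator_def dest: chol_det_pos)
  then have em: "emeasure ?C ?A = ennreal (\<Prod>p<d. Beta (1/2) (0 + real p / 2 + 1) ^ Suc p)"
    by (simp only: det_moment_closed_form)
  have "(\<integral>\<^sup>+\<omega>. ennreal (Determinant.det (R \<omega>) powr s) \<partial>M) =
      (\<integral>\<^sup>+\<omega>. ennreal (chol_det (Suc d) (?X \<omega>) powr s) \<partial>M)"
    by (intro nn_integral_cong) (simp add: eq)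
  also have "\<dots> = (\<integral>\<^sup>+x. ennreal (chol_det (Suc d) x powr s) \<partial>distr M ?C ?X)"
    by (subst nn_integral_distr) auto
  also have "\<dots> = (\<integral>\<^sup>+x. ennreal (chol_det (Suc d) x powr s) * indicator ?A x \<partial>?C) / emeasure ?C ?A"
    unfolding distr by (rule nn_integral_uniform_measure) auto
  also have "(\<integral>\<^sup>+x. ennreal (chol_det (Suc d) x powr s) * indicator ?A x \<partial>?C) = det_moment (Suc d) s"
    unfolding det_moment_def by (intro nn_integral_cong) (auto simp: indicator_def)
  \<comment> \<open>The volume is a positive finite product of Beta values, so division in
    \<open>ennreal\<close> agrees with real division.\<close>
  also have "\<dots> / emeasure ?C ?A = ennreal (det_moment_ratio d s)"
    unfolding em det_moment_closed_form[OF assms(2)] det_moment_ratio_def power_divide prod_dividef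
    unfolding add_0
    by (intro divide_ennreal prod_pos prod_nonneg zero_less_power zero_le_power ballI
        Beta_half_real_pos less_imp_le[OF Beta_half_real_pos])
      (use assms(2) in auto)
  finally show "(\<integral>\<^sup>+\<omega>. ennreal (Determinant.det (R \<omega>) powr s) \<partial>M) = ennreal (det_moment_ratio d s)" .
qed

text \<open>Markov's inequality for a power of the determinant; a negative \<open>s\<close> turns it
  into a bound on the probability of small determinants.\<close>

lemma prob_det_powr_ge:
  assumes "prob_space M" "uniform_correlation_matrix (Suc d) M R" "s > -1" "a > 0"
  shows "measure M {\<omega> \<in> space M. Determinant.det (R \<omega>) powr s \<ge> a} \<le> det_moment_ratio d s / a"
proof -
  interpret prob_space M by fact
  note moment = nn_integral_det_powr[OF assms(2,3)]
  note [measurable] = moment(1)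
  have ratio: "det_moment_ratio d s \<ge> 0"
    using assms(3) by (rule det_moment_ratio_nonneg)
  have iff: "1 \<le> ennreal (1 / a) * ennreal (y powr s) \<longleftrightarrow> y powr s \<ge> a" for y
    using assms(4) by (simp add: ennreal_mult'[symmetric] pos_le_divide_eq)
  have "emeasure M {\<omega> \<in> space M. 1 \<le> ennreal (1 / a) * ennreal (Determinant.det (R \<omega>) powr s)}
     \<le> ennreal (1 / a) * (\<integral>\<^sup>+\<omega>. ennreal (Determinant.det (R \<omega>) powr s) * indicator (space M) \<omega> \<partial>M)"
    by (rule nn_integral_Markov_inequality) measurable
  also have "\<dots> = ennreal (1 / a) * ennreal (det_moment_ratio d s)"
    unfolding moment(2)[symmetric] by (intro arg_cong2[where f = "(*)"] refl nn_integral_cong) auto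
  also have "\<dots> = ennreal (det_moment_ratio d s / a)"
    using assms(4) by (simp add: ennreal_mult'[symmetric])
  finally show ?thesis
    unfolding iff emeasure_eq_measure using assms(4) ratio by (subst (asm) ennreal_le_iff) auto
qed

subsection \<open>Asymptotics of the moments\<close>

lemma det_moment_ratio_Suc:
  "det_moment_ratio (Suc d) s =
     (Beta (1/2) (s + real d / 2 + 1) / Beta (1/2) (real d / 2 + 1)) ^ Suc d * det_moment_ratio d s"
  by (simp add: det_moment_ratio_def)



section \<open>Ratios of Beta values\<close>

lemma Beta_half_shift:
  assumes "y > (0::real)"
  shows "Beta (1/2) (y + 1) = y / (y + 1/2) * Beta (1/2) y"
proof -
  have "y \<notin> \<int>\<^sub>\<le>\<^sub>0" using assms by (auto elim!: nonpos_Ints_cases)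
  then have "(1/2 + y) * Beta (1/2) (y + 1) = y * Beta (1/2) y" by (rule Beta_plus1_right)
  then show ?thesis using assms by (simp add: field_simps)
qed

text \<open>Cauchy-Schwarz for the Beta integrals, obtained by integrating the nonnegative square (l
  u - v)^2 against a weight.\<close>

lemma Beta_half_log_convex:
  assumes b: "b > (0::real)"
  shows "(Beta (1/2) (b + 1/2))\<^sup>2 \<le> Beta (1/2) b * Beta (1/2) (b + 1)"
proof -
  let ?f = "\<lambda>c t. t powr (1/2 - 1) * (1 - t) powr (c - 1) :: real"
  let ?B0 = "Beta (1/2) b" and ?B1 = "Beta (1/2) (b + 1/2)" and ?B2 = "Beta (1/2) (b + 1)"
  have pos: "?B0 > 0" using Beta_half_real_pos[OF b] .
  \<comment> \<open>The minimizer of l^2 B0 - 2 l B1 + B2, which gives the sharp inequality.\<close>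
  define l where "l = ?B1 / ?B0"
  have int: "(?f c has_integral Beta (1/2) c) {0..1}" if "c > 0" for c
    using has_integral_Beta_real[of "1/2" c] that by simp
  have "2 * l * ?B1 \<le> l\<^sup>2 * ?B0 + ?B2"
  proof (rule has_integral_le)
    show "((\<lambda>t. 2 * l * ?f (b + 1/2) t) has_integral 2 * l * ?B1) {0..1}"
      using b by (intro has_integral_mult_right int) auto
    show "((\<lambda>t. l\<^sup>2 * ?f b t + ?f (b + 1) t) has_integral l\<^sup>2 * ?B0 + ?B2) {0..1}"
      using b by (intro has_integral_add has_integral_mult_right int) auto
    fix t :: real assume t: "t \<in> {0..1}"
    \<comment> \<open>With these half powers the three integrands carry u^2, u v and v^2.\<close>
    define u v where "u = (1 - t) powr ((b - 1) / 2)" and "v = (1 - t) powr (b / 2)"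
    have "b - 1 = (b - 1) / 2 + (b - 1) / 2" "b + 1/2 - 1 = (b - 1) / 2 + b / 2"
      "b + 1 - 1 = b / 2 + b / 2"
      by (simp_all add: field_simps)
    then have uv: "(1 - t) powr (b - 1) = u * u" "(1 - t) powr (b + 1/2 - 1) = u * v"
      "(1 - t) powr (b + 1 - 1) = v * v"
      unfolding u_def v_def powr_add[symmetric] by simp_all
    have "0 \<le> t powr (1/2 - 1) * (l * u - v)\<^sup>2" by simp
    then show "2 * l * ?f (b + 1/2) t \<le> l\<^sup>2 * ?f b t + ?f (b + 1) t"
      unfolding uv by (simp add: power2_eq_square algebra_simps)
  qed
  then have "?B1\<^sup>2 / ?B0 \<le> ?B2"
    using pos by (simp add: l_def power2_eq_square field_simps)
  then show ?thesis using pos by (simp add: field_simps)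
qed

text \<open>Log-convexity bounds the half-step by two values a full step apart, whose quotient the
  shift formula gives exactly.\<close>

lemma Beta_half_ratio_le:
  assumes b: "b > (0::real)"
  shows "Beta (1/2) (b + 1/2) / Beta (1/2) (b + 1) \<le> sqrt ((b + 1/2) / b)"
proof -
  have pos: "Beta (1/2) (b + 1) > 0" using b by (intro Beta_half_real_pos) simp
  have "Beta (1/2) b = (b + 1/2) / b * Beta (1/2) (b + 1)"
    using Beta_half_shift[OF b] b by (simp add: field_simps)
  with Beta_half_log_convex[OF b]
  have "(Beta (1/2) (b + 1/2))\<^sup>2 \<le> (b + 1/2) / b * (Beta (1/2) (b + 1))\<^sup>2"
    by (simp add: power2_eq_square mult.assoc)
  then have "(Beta (1/2) (b + 1/2) / Beta (1/2) (b + 1))\<^sup>2 \<le> (b + 1/2) / b"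
    using pos by (simp add: power_divide divide_le_eq)
  then show ?thesis by (rule real_le_rsqrt)
qed

section \<open>Ratio test and limits of the tail bounds\<close>

lemma tendsto_0_ratio:
  fixes a \<rho> :: "nat \<Rightarrow> real"
  assumes "\<And>n. a n \<ge> 0" "eventually (\<lambda>n. a (Suc n) \<le> \<rho> n * a n) sequentially"
    and "\<rho> \<longlonglongrightarrow> r" "r < 1"
  shows "a \<longlonglongrightarrow> 0"
proof -
  obtain c where c: "r < c" "c < 1" using assms(4) dense by blast
  have "eventually (\<lambda>n. a (Suc n) \<le> \<rho> n * a n \<and> \<rho> n < c) sequentially"
    using assms(2) order_tendstoD(2)[OF assms(3) c(1)] by (rule eventually_conj)
  then obtain N where N: "\<And>n. n \<ge> N \<Longrightarrow> a (Suc n) \<le> \<rho> n * a n \<and> \<rho> n < c"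
    by (auto simp: eventually_sequentially)
  have "summable a"
  proof (rule summable_ratio_test[OF c(2)])
    fix n assume "n \<ge> N"
    with N have "a (Suc n) \<le> \<rho> n * a n" "\<rho> n < c" by auto
    then have "a (Suc n) \<le> c * a n"
      using mult_right_mono[of "\<rho> n" c "a n"] assms(1)[of n] by linarith
    then show "norm (a (Suc n)) \<le> c * norm (a n)" using assms(1) by simp
  qed
  then show ?thesis by (rule summable_LIMSEQ_zero)
qed

text \<open>For s = 1 the Beta quotient is exactly (n + 2) / (n + 3), and its power
  \<open>Suc n\<close> tends to exp (-1), below the growth rate c of the threshold.\<close>

lemma upper_tail_tendsto_0:
  assumes "c > exp (-1)"
  shows "(\<lambda>d. det_moment_ratio d 1 / c ^ Suc d) \<longlonglongrightarrow> 0"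
proof (rule tendsto_0_ratio)
  have c: "c > 0" using assms exp_gt_zero less_trans by blast
  show "det_moment_ratio n 1 / c ^ Suc n \<ge> 0" for n
    using c det_moment_ratio_nonneg[of 1 n] by simp
  let ?r = "\<lambda>n. ((real n + 2) / (real n + 3)) ^ Suc n / c"
  have "Beta (1/2) (1 + real n / 2 + 1) / Beta (1/2) (real n / 2 + 1) = (real n + 2) / (real n + 3)" for n
    using Beta_half_shift[of "real n / 2 + 1"] Beta_half_real_pos[of "real n / 2 + 1"]
    by (simp add: field_simps)
  then have "det_moment_ratio (Suc n) 1 / c ^ Suc (Suc n) = ?r n * (det_moment_ratio n 1 / c ^ Suc n)" for n
    by (simp add: det_moment_ratio_Suc)
  then show "\<forall>\<^sub>F n in sequentially. det_moment_ratio (Suc n) 1 / c ^ Suc (Suc n)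
      \<le> ?r n * (det_moment_ratio n 1 / c ^ Suc n)"
    by simp
  have "(\<lambda>n. ((real n + 2) / (real n + 3)) powr (real n + 1)) \<longlonglongrightarrow> exp (-1)"
    by real_asymp
  also have "(\<lambda>n. ((real n + 2) / (real n + 3)) powr (real n + 1)) =
      (\<lambda>n. ((real n + 2) / (real n + 3)) ^ Suc n)"
    by (intro ext) (subst powr_realpow[symmetric], auto simp: add_ac)
  finally show "?r \<longlonglongrightarrow> exp (-1) / c"
    by (rule tendsto_divide[OF _ tendsto_const]) (use c in simp)
  show "exp (-1) / c < 1" using assms c by (simp add: field_simps)
qed

text \<open>For s = -1/2 consecutive terms have ratio at most sqrt ((n + 1) / n)^(n + 1) * sqrt c,
  with limit exp (1/2) * sqrt c; this is below 1 exactly when c < exp (-1).\<close>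

lemma lower_tail_tendsto_0:
  assumes "c > 0" "c < exp (-1)"
  shows "(\<lambda>d. det_moment_ratio d (-1/2) / (c ^ Suc d) powr (-1/2)) \<longlonglongrightarrow> 0"
proof (rule tendsto_0_ratio)
  let ?a = "\<lambda>d. det_moment_ratio d (-1/2) / (c ^ Suc d) powr (-1/2)"
  let ?r = "\<lambda>n. sqrt ((real n + 1) / real n) ^ Suc n * sqrt c"
  show "?a n \<ge> 0" for n
    using det_moment_ratio_nonneg[of "-1/2" n] by simp
  \<comment> \<open>The Beta bound is applied at b = n / 2, which must be positive; hence n = 0 is
    excluded.\<close>
  have step: "?a (Suc n) \<le> ?r n * ?a n" if n: "n > 0" for n
  proof -
    let ?q = "Beta (1/2) (-1/2 + real n / 2 + 1) / Beta (1/2) (real n / 2 + 1)"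
    have q: "?q = Beta (1/2) (real n / 2 + 1/2) / Beta (1/2) (real n / 2 + 1)"
      by (simp add: add_ac)
    have "0 \<le> ?q" using n unfolding q by (intro divide_nonneg_nonneg less_imp_le[OF Beta_half_real_pos]) auto
    moreover have "?q \<le> sqrt ((real n + 1) / real n)"
    proof -
      have "(real n / 2 + 1/2) / (real n / 2) = (real n + 1) / real n"
        using n by (simp add: field_simps)
      then show ?thesis using Beta_half_ratio_le[of "real n / 2"] n unfolding q by simp
    qed
    ultimately have *: "?q ^ Suc n \<le> sqrt ((real n + 1) / real n) ^ Suc n" by (rule power_mono[rotated])
    have inv: "1 / (c ^ Suc (Suc n)) powr (-1/2) = sqrt c * (1 / (c ^ Suc n) powr (-1/2))"
    proof -
      have "c powr (-1/2) = 1 / sqrt c"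
        unfolding minus_divide_left[symmetric] powr_minus
        using assms by (simp only: powr_half_sqrt less_imp_le inverse_eq_divide)
      then show ?thesis
        unfolding power_Suc[of c "Suc n"] using assms by (subst powr_mult) auto
    qed
    have "?a (Suc n) = ?q ^ Suc n * det_moment_ratio n (-1/2) * (1 / (c ^ Suc (Suc n)) powr (-1/2))"
      unfolding det_moment_ratio_Suc by (simp only: times_divide_eq_right mult_1_right)
    also have "\<dots> = ?q ^ Suc n * sqrt c * ?a n"
      unfolding inv by (simp only: divide_inverse mult_1_left mult_ac)
    also have "\<dots> \<le> ?r n * ?a n"
      using * assms det_moment_ratio_nonneg[of "-1/2" n] by (intro mult_right_mono) auto
    finally show ?thesis .
  qed
  show "\<forall>\<^sub>F n in sequentially. ?a (Suc n) \<le> ?r n * ?a n"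
    using eventually_gt_at_top[of 0] by eventually_elim (rule step)
  have "(\<lambda>n. (sqrt ((real n + 1) / real n)) powr (real n + 1)) \<longlonglongrightarrow> exp (1/2)"
    by real_asymp
  moreover have "\<forall>\<^sub>F n in sequentially. (sqrt ((real n + 1) / real n)) powr (real n + 1) =
      sqrt ((real n + 1) / real n) ^ Suc n"
    using eventually_gt_at_top[of 0]
    by eventually_elim (subst powr_realpow[symmetric], auto simp: add_ac)
  ultimately have "(\<lambda>n. sqrt ((real n + 1) / real n) ^ Suc n) \<longlonglongrightarrow> exp (1/2)"
    using tendsto_cong by fast
  then show "?r \<longlonglongrightarrow> exp (1/2) * sqrt c"
    by (intro tendsto_mult tendsto_const)
  have "sqrt c < sqrt (exp (-1))" using assms by simp
  also have "sqrt (exp (-1)) = exp (-1/2 :: real)"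
    by (rule real_sqrt_unique) (simp_all add: power2_eq_square exp_add[symmetric])
  finally have "exp (1/2) * sqrt c < exp (1/2) * exp (-1/2)" by simp
  then show "exp (1/2) * sqrt c < 1" by (simp add: exp_add[symmetric])
qed

section \<open>Convergence in probability of the d-th root\<close>

theorem theorem3:
  fixes M :: "nat \<Rightarrow> 'a measure" and R :: "nat \<Rightarrow> 'a \<Rightarrow> real mat"
  assumes "\<And>d. d \<ge> 1 \<Longrightarrow> prob_space (M d)"
    and "\<And>d. d \<ge> 1 \<Longrightarrow> uniform_correlation_matrix d (M d) (R d)"
  shows "tendsto_in_probability M
           (\<lambda>d \<omega>. Determinant.det (R d \<omega>) powr (1 / real d)) (1 / exp 1)"
  unfolding tendsto_in_probability_def
proof (intro allI impI)
  fix \<epsilon> :: real assume \<epsilon>: "\<epsilon> > 0"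
  let ?D = "\<lambda>d \<omega>. Determinant.det (R d \<omega>)"
  let ?P = "\<lambda>d. measure (M d) {\<omega> \<in> space (M d). \<bar>?D d \<omega> powr (1 / real d) - 1 / exp 1\<bar> > \<epsilon>}"
  define a where "a = exp (-1) + \<epsilon>"
  \<comment> \<open>The maximum keeps \<open>b\<close> positive even when \<open>\<epsilon>\<close>
    is at least exp (-1).\<close>
  define b where "b = max (exp (-1) - \<epsilon>) (exp (-1) / 2)"
  have a: "a > exp (-1)" "a > 0" using \<epsilon> by (auto simp: a_def add_pos_pos)
  have b: "b > 0" "b < exp (-1)" using \<epsilon> by (auto simp: b_def less_max_iff_disj)
  let ?U = "\<lambda>d. det_moment_ratio d 1 / a ^ Suc d"
  let ?L = "\<lambda>d. det_moment_ratio d (-1/2) / (b ^ Suc d) powr (-1/2)"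
  \<comment> \<open>Dimensions start at 1 and the moment ratios are indexed one lower, so the limit
    is taken along \<open>Suc d\<close> and shifted back at the end.\<close>
  have bound: "?P (Suc d) \<le> ?U d + ?L d" for d
  proof -
    let ?n = "Suc d"
    interpret prob_space "M ?n" using assms(1) by simp
    have unif: "uniform_correlation_matrix ?n (M ?n) (R ?n)" using assms(2) by simp
    have [measurable]: "?D ?n \<in> borel_measurable (M ?n)"
      using nn_integral_det_powr(1)[OF unif, of 0] by simp
    have pos: "?D ?n \<omega> > 0" if "\<omega> \<in> space (M ?n)" for \<omega>
    proof -
      have cor: "R ?n \<omega> \<in> correlation_matrices ?n"
        using unif that by (simp add: uniform_correlation_matrix_def)
      have "upper_entries ?n (R ?n \<omega>) \<in> chol_region ?n"
        using upper_entries_correlation_matrices[of ?n] cor by blast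
      then show ?thesis using det_correlation_matrix[OF cor] chol_det_pos by simp
    qed
    let ?EU = "{\<omega> \<in> space (M ?n). ?D ?n \<omega> powr 1 \<ge> a ^ ?n}"
    let ?EL = "{\<omega> \<in> space (M ?n). ?D ?n \<omega> powr (-1/2) \<ge> (b ^ ?n) powr (-1/2)}"
    have split: "?D ?n \<omega> powr 1 \<ge> a ^ ?n \<or> ?D ?n \<omega> powr (-1/2) \<ge> (b ^ ?n) powr (-1/2)"
      if \<omega>: "\<omega> \<in> space (M ?n)" and far: "\<bar>?D ?n \<omega> powr (1 / real ?n) - 1 / exp 1\<bar> > \<epsilon>" for \<omega>
    proof -
      define y where "y = ?D ?n \<omega> powr (1 / real ?n)"
      have y: "y > 0" "y ^ ?n = ?D ?n \<omega>"
        using pos[OF \<omega>] by (simp_all add: y_def powr_realpow[symmetric] powr_powr del: power_Suc)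
      \<comment> \<open>A deviation above \<open>\<epsilon>\<close> means y > a or y < exp (-1) -
        \<epsilon>, and the latter bound is at most \<open>b\<close>.\<close>
      have "y \<ge> a \<or> y \<le> b"
        using far unfolding y_def[symmetric] a_def b_def by (auto simp: exp_minus inverse_eq_divide)
      then show ?thesis
      proof
        assume "y \<ge> a"
        then have "a ^ ?n \<le> y ^ ?n" using a by (intro power_mono) auto
        then show ?thesis using y pos[OF \<omega>] by simp
      next
        assume "y \<le> b"
        then have "y ^ ?n \<le> b ^ ?n" using y by (intro power_mono) auto
        \<comment> \<open>The negative exponent reverses the order, so a small determinant becomes a
          large power.\<close>
        then have "(b ^ ?n) powr (-1/2) \<le> (y ^ ?n) powr (-1/2)"
          using y(1) by (intro powr_mono2' zero_less_power) auto
        then show ?thesis using y by simp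
      qed
    qed
    have "?P ?n \<le> prob (?EU \<union> ?EL)"
      by (rule finite_measure_mono) (use split in auto)
    also have "\<dots> \<le> prob ?EU + prob ?EL"
      by (rule measure_Un_le) auto
    also have "prob ?EU \<le> ?U d"
      using a by (intro prob_det_powr_ge[OF prob_space_axioms unif]) auto
    also have "prob ?EL \<le> ?L d"
      using b by (intro prob_det_powr_ge[OF prob_space_axioms unif]) auto
    finally show ?thesis by simp
  qed
  have lim: "(\<lambda>d. ?U d + ?L d) \<longlonglongrightarrow> 0"
    using tendsto_add[OF upper_tail_tendsto_0[OF a(1)] lower_tail_tendsto_0[OF b]] by simp
  have "(\<lambda>d. ?P (Suc d)) \<longlonglongrightarrow> 0"
    by (rule tendsto_sandwich[OF _ _ tendsto_const lim])
      (intro always_eventually allI measure_nonneg bound)+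
  then show "?P \<longlonglongrightarrow> 0" by (rule LIMSEQ_imp_Suc)
qed

end
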